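(* Let $\mathcal{A}$ and $\mathcal{B}$ be 2-torsion free semiprime associative rings (not assumed unital), and let $\mathcal{M}$ be a 2-torsion free faithful $(\mathcal{A},\mathcal{B})$-bimodule such that $\{m\in\mathcal{M} : \mathcal{A}m=\{0\}\}=\{0\}$ and $\{m\in\mathcal{M} : m\mathcal{B}=\{0\}\}=\{0\}$. Let $\mathfrak{T}=Tri(\mathcal{A},\mathcal{M},\mathcal{B})$ be the associated triangular ring. Let $\Phi:\mathfrak{T}\to\mathfrak{T}$ be a Jordan generalized derivation associated with a Jordan derivation $\Delta:\mathfrak{T}\to\mathfrak{T}$; that is, $\Phi$ and $\Delta$ are additive maps with $$\Phi(X\circ Y)=\Phi(X)\circ Y+X\circ\Delta(Y)\quad\text{and}\quad \Delta(X\circ Y)=\Delta(X)\circ Y+X\circ\Delta(Y)$$ for all $X,Y\in\mathfrak{T}$. Then $\Delta$ is a derivation and $\Phi$ is a two-sided generalized derivation associated with the derivation $\Delta$.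
   Context: Rings are associative and need not have a unity; modules are not assumed unital. An $(\mathcal{A},\mathcal{B})$-bimodule $\mathcal{M}$ is faithful if it is faithful as a left $\mathcal{A}$-module ($a\mathcal{M}=\{0\}$ implies $a=0$) and as a right $\mathcal{B}$-module ($\mathcal{M}b=\{0\}$ implies $b=0$). The triangular ring $Tri(\mathcal{A},\mathcal{M},\mathcal{B})$ is the set of all matrices $\begin{bmatrix} a & m\\ 0 & b\end{bmatrix}$ with $a\in\mathcal{A}$, $m\in\mathcal{M}$, $b\in\mathcal{B}$, under the usual matrix operations. A ring or module $R$ is 2-torsion free if $2x=0$ implies $x=0$. A ring $\mathcal{R}$ is semiprime if $x\mathcal{R}x=\{0\}$ implies $x=0$. The Jordan product is $x\circ y=xy+yx$. An additive map $\Delta:\mathcal{R}\to\mathcal{R}$ is a derivation if $\Delta(xy)=\Delta(x)y+x\Delta(y)$ for all $x,y\in\mathcal{R}$. An additive map $\Phi:\mathcal{R}\to\mathcal{R}$ is a two-sided generalized derivation associated with a derivation $\Delta$ if $\Phi(xy)=\Phi(x)y+x\Delta(y)=x\Phi(y)+\Delta(x)y$ for all $x,y\in\mathcal{R}$. *)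

theory Defs
  imports Complex_Main "HOL-Library.Product_Plus"
begin

text \<open>
  The type class \<open>ring\<close> of HOL is the class of associative rings that need not have a unity.
  Accordingly no unitality is imposed on the two actions of a bimodule.
\<close>

locale bimodule =
  fixes lact :: "'a::ring \<Rightarrow> 'm::ab_group_add \<Rightarrow> 'm"
    and ract :: "'m \<Rightarrow> 'b::ring \<Rightarrow> 'm"
  assumes lact_add_left: "lact (a + a') m = lact a m + lact a' m"
    and lact_add_right: "lact a (m + m') = lact a m + lact a m'"
    and lact_mult: "lact (a * a') m = lact a (lact a' m)"
    and ract_add_left: "ract (m + m') b = ract m b + ract m' b"
    and ract_add_right: "ract m (b + b') = ract m b + ract m b'"
    and ract_mult: "ract m (b * b') = ract (ract m b) b'"
    and lact_ract: "ract (lact a m) b = lact a (ract m b)"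

locale faithful_bimodule = bimodule +
  assumes left_faithful: "(\<forall>m. lact a m = 0) \<Longrightarrow> a = 0"
    and right_faithful: "(\<forall>m. ract m b = 0) \<Longrightarrow> b = 0"

definition two_torsion_free :: "'a::ab_group_add itself \<Rightarrow> bool"
  where "two_torsion_free _ \<longleftrightarrow> (\<forall>x::'a. x + x = 0 \<longrightarrow> x = 0)"

definition semiprime_ring :: "'a::ring itself \<Rightarrow> bool"
  where "semiprime_ring _ \<longleftrightarrow> (\<forall>x::'a. (\<forall>r. x * r * x = 0) \<longrightarrow> x = 0)"

text \<open>
  The triple \<open>(a, m, b)\<close> stands for the upper triangular matrix with diagonal entries \<open>a\<close>, \<open>b\<close>
  and upper right entry \<open>m\<close>.  The entrywise addition is the one that \<open>Product_Plus\<close> provides.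
  The multiplication depends on the two actions, so it is a parameterised operation and not
  an instance of the class \<open>times\<close>.
\<close>

type_synonym ('a, 'm, 'b) tri = "'a \<times> 'm \<times> 'b"

fun tri_mult :: "('a::ring \<Rightarrow> 'm::ab_group_add \<Rightarrow> 'm) \<Rightarrow> ('m \<Rightarrow> 'b::ring \<Rightarrow> 'm) \<Rightarrow>
    ('a, 'm, 'b) tri \<Rightarrow> ('a, 'm, 'b) tri \<Rightarrow> ('a, 'm, 'b) tri"
  where "tri_mult lact ract (a, m, b) (a', m', b') = (a * a', lact a m' + ract m b', b * b')"

lemma (in bimodule) tri_ring:
  "class.ring (+) 0 (-) uminus (tri_mult lact ract)"
proof
  fix x y z :: "('a, 'm, 'b) tri"
  show "tri_mult lact ract (tri_mult lact ract x y) z =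
      tri_mult lact ract x (tri_mult lact ract y z)"
    by (cases x rule: prod_cases3; cases y rule: prod_cases3; cases z rule: prod_cases3)
      (simp add: lact_add_right lact_mult ract_add_left ract_mult lact_ract mult.assoc add.assoc)
  show "tri_mult lact ract (x + y) z = tri_mult lact ract x z + tri_mult lact ract y z"
    by (cases x rule: prod_cases3; cases y rule: prod_cases3; cases z rule: prod_cases3)
      (simp add: lact_add_left ract_add_left distrib_right add_ac)
  show "tri_mult lact ract x (y + z) = tri_mult lact ract x y + tri_mult lact ract x z"
    by (cases x rule: prod_cases3; cases y rule: prod_cases3; cases z rule: prod_cases3)
      (simp add: lact_add_right ract_add_right distrib_left add_ac)
qed

text \<open>
  The notions below are for a ring with the addition of its type and the explicitly given
  multiplication \<open>mul\<close>.
\<close>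

definition jordan_product :: "('r \<Rightarrow> 'r \<Rightarrow> 'r) \<Rightarrow> 'r::ab_group_add \<Rightarrow> 'r \<Rightarrow> 'r"
  where "jordan_product mul x y = mul x y + mul y x"

definition derivation :: "('r \<Rightarrow> 'r \<Rightarrow> 'r) \<Rightarrow> ('r::ab_group_add \<Rightarrow> 'r) \<Rightarrow> bool"
  where "derivation mul \<Delta> \<longleftrightarrow> additive \<Delta> \<and>
    (\<forall>x y. \<Delta> (mul x y) = mul (\<Delta> x) y + mul x (\<Delta> y))"

definition two_sided_generalized_derivation ::
    "('r \<Rightarrow> 'r \<Rightarrow> 'r) \<Rightarrow> ('r::ab_group_add \<Rightarrow> 'r) \<Rightarrow> ('r \<Rightarrow> 'r) \<Rightarrow> bool"
  where "two_sided_generalized_derivation mul \<Phi> \<Delta> \<longleftrightarrow>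
    derivation mul \<Delta> \<and> additive \<Phi> \<and>
    (\<forall>x y. \<Phi> (mul x y) = mul (\<Phi> x) y + mul x (\<Delta> y) \<and>
           \<Phi> (mul x y) = mul x (\<Phi> y) + mul (\<Delta> x) y)"

definition jordan_derivation :: "('r \<Rightarrow> 'r \<Rightarrow> 'r) \<Rightarrow> ('r::ab_group_add \<Rightarrow> 'r) \<Rightarrow> bool"
  where "jordan_derivation mul \<Delta> \<longleftrightarrow> additive \<Delta> \<and>
    (\<forall>x y. \<Delta> (jordan_product mul x y) =
      jordan_product mul (\<Delta> x) y + jordan_product mul x (\<Delta> y))"

definition jordan_generalized_derivation ::
    "('r \<Rightarrow> 'r \<Rightarrow> 'r) \<Rightarrow> ('r::ab_group_add \<Rightarrow> 'r) \<Rightarrow> ('r \<Rightarrow> 'r) \<Rightarrow> bool"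
  where "jordan_generalized_derivation mul \<Phi> \<Delta> \<longleftrightarrow>
    jordan_derivation mul \<Delta> \<and> additive \<Phi> \<and>
    (\<forall>x y. \<Phi> (jordan_product mul x y) =
      jordan_product mul (\<Phi> x) y + jordan_product mul x (\<Delta> y))"

end

theory Submission
  imports Defs
begin

text \<open>
  Everything is read off from matrix entries.  Without identities in \<open>A\<close> and \<open>B\<close> there may be no
  idempotent giving a Peirce decomposition; its role is played by two cancellation principles:
  in a 2-torsion free semiprime ring only \<open>0\<close> anticommutes with every element, and an element of
  \<open>A\<close>, \<open>B\<close> or \<open>M\<close> is determined by the way it acts or is acted upon.

  Apply the Jordan identity to pairs of matrices that have one nonzero entry each.  The product
  \<open>a \<circ> b\<close> of diagonal entries in opposite corners is \<open>0\<close>, and this forces a Jordan derivation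
  \<open>\<Delta>\<close> not to mix the two corners.  From \<open>a \<circ> m = a m\<close>, \<open>m \<circ> b = m b\<close> and \<open>m \<circ> m' = 0\<close> one
  finds that \<open>\<Delta>\<close> maps \<open>M\<close> to itself.  On products of the form \<open>a m\<close> and \<open>m b\<close> the Jordan identity
  is then an honest Leibniz rule, and computing \<open>\<Delta> (a a' m)\<close> in two ways yields the Leibniz rule
  for the corner \<open>A\<close> by faithfulness, likewise for \<open>B\<close>.  What is left are the \<open>M\<close>-entries \<open>\<mu> a\<close> of
  \<open>\<Delta> a\<close> and \<open>\<nu> b\<close> of \<open>\<Delta> b\<close>; they are governed by \<open>\<mu> a b + a \<nu> b = 0\<close>, which again comes from
  \<open>a \<circ> b = 0\<close>.  These rules, collected in \<open>jordan_derivation_tri_form\<close>, add up to the Leibniz rule.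

  For \<open>\<Phi>\<close>, the difference \<open>\<Psi> = \<Phi> - \<Delta>\<close> satisfies \<open>\<Psi> (X \<circ> Y) = \<Psi> X \<circ> Y\<close>, because the \<open>\<Delta>\<close>-terms
  cancel, and hence also \<open>\<Psi> (X \<circ> Y) = X \<circ> \<Psi> Y\<close>.  The same entrywise analysis, in
  \<open>jordan_centralizer_tri_form\<close>, shows that \<open>\<Psi>\<close> maps each of \<open>A\<close>, \<open>M\<close> and \<open>B\<close> to itself and that
  \<open>\<Psi> (X Y) = \<Psi> X Y = X \<Psi> Y\<close>; adding \<open>\<Delta>\<close> back gives the two product rules for \<open>\<Phi>\<close>.
\<close>

section \<open>Cancellation in semiprime rings\<close>

lemma semiprimeD:
  fixes x :: "'a::ring"
  assumes "semiprime_ring TYPE('a)" and "\<And>r. x * r * x = 0"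
  shows "x = 0"
  using assms unfolding semiprime_ring_def by blast

lemma semiprime_left_cancel:
  fixes x :: "'a::ring"
  assumes "semiprime_ring TYPE('a)" and "\<And>r. r * x = 0"
  shows "x = 0"
  by (rule semiprimeD[OF assms(1)]) (simp add: assms(2))

lemma semiprime_right_cancel:
  fixes x :: "'a::ring"
  assumes "semiprime_ring TYPE('a)" and "\<And>r. x * r = 0"
  shows "x = 0"
  by (rule semiprimeD[OF assms(1)]) (simp add: assms(2))

text \<open>
  Moving \<open>x\<close> past \<open>r\<close> and then past \<open>s\<close> costs two signs, moving it past \<open>r s\<close> at once costs only
  one; hence \<open>2 r s x = 0\<close>.
\<close>

lemma semiprime_anticommuting_eq_0:
  fixes x :: "'a::ring"
  assumes "two_torsion_free TYPE('a)" and "semiprime_ring TYPE('a)"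
    and anti: "\<And>r. x * r + r * x = 0"
  shows "x = 0"
proof -
  have "r * s * x = 0" for r s
  proof -
    have swap: "x * t = - (t * x)" for t
      using anti[of t] by (simp add: eq_neg_iff_add_eq_0)
    have "x * (r * s) = - (r * x) * s"
      by (simp add: swap[of r] flip: mult.assoc)
    also have "\<dots> = r * s * x"
      by (simp add: mult.assoc swap[of s])
    finally have "r * s * x + r * s * x = 0"
      using anti[of "r * s"] by simp
    with assms(1) show ?thesis
      unfolding two_torsion_free_def by blast
  qed
  then show ?thesis by (rule semiprimeD[OF assms(2)])
qed

section \<open>Triangular rings over semiprime corners\<close>

context bimodule
begin

sublocale lact_left: additive "\<lambda>a. lact a m" for m
  by unfold_locales (rule lact_add_left)

sublocale lact_right: additive "\<lambda>m. lact a m" for a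
  by unfold_locales (rule lact_add_right)

sublocale ract_left: additive "\<lambda>m. ract m b" for b
  by unfold_locales (rule ract_add_left)

sublocale ract_right: additive "\<lambda>b. ract m b" for m
  by unfold_locales (rule ract_add_right)

lemmas act_simps =
  lact_left.zero lact_right.zero ract_left.zero ract_right.zero
  lact_add_left lact_add_right ract_add_left ract_add_right

abbreviation tmul (infixl \<open>\<star>\<close> 70) where "tmul \<equiv> tri_mult lact ract"

lemma tri_mult_add_left: "(x + y) \<star> z = x \<star> z + y \<star> z"
  and tri_mult_add_right: "x \<star> (y + z) = x \<star> y + x \<star> z"
  by (cases x; cases y; cases z; simp add: act_simps algebra_simps)+

lemma jordan_product_tri [simp]:
  "jordan_product tmul (a, m, b) (a', m', b') =
    (a * a' + a' * a, lact a m' + ract m b' + (lact a' m + ract m' b), b * b' + b' * b)"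
  by (simp add: jordan_product_def)

lemma jordan_product_tri_diff_left:
  "jordan_product tmul (x - y) z = jordan_product tmul x z - jordan_product tmul y z"
proof -
  have "jordan_product tmul (x - y) z + jordan_product tmul y z = jordan_product tmul x z"
    unfolding jordan_product_def
    using tri_mult_add_left[of "x - y" y z] tri_mult_add_right[of z "x - y" y]
    by (simp add: algebra_simps)
  then show ?thesis by (simp add: eq_diff_eq)
qed

lemma jordan_product_commute: "jordan_product tmul x y = jordan_product tmul y x"
  by (simp add: jordan_product_def add.commute)

end

lemma additive_tri_split:
  fixes F :: "('a::ab_group_add \<times> 'm::ab_group_add \<times> 'b::ab_group_add) \<Rightarrow> 'c::ab_group_add"
  assumes "additive F"
  shows "F (a, m, b) = F (a, 0, 0) + F (0, m, 0) + F (0, 0, b)"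
proof -
  have "F (a, m, b) = F ((a, 0, 0) + (0, m, 0) + (0, 0, b))" by simp
  also have "\<dots> = F (a, 0, 0) + F (0, m, 0) + F (0, 0, b)"
    by (simp only: additive.add[OF assms])
  finally show ?thesis .
qed

lemma triple_valued_components:
  obtains p q r where "\<And>x. F x = (p x, q x, r x)"
  by (rule that[of "\<lambda>x. fst (F x)" "\<lambda>x. fst (snd (F x))" "\<lambda>x. snd (snd (F x))"]) simp

locale semiprime_bimodule = faithful_bimodule lact ract
  for lact :: "'a::ring \<Rightarrow> 'm::ab_group_add \<Rightarrow> 'm"
    and ract :: "'m \<Rightarrow> 'b::ring \<Rightarrow> 'm" +
  assumes torsion_a: "two_torsion_free TYPE('a)" and semiprime_a: "semiprime_ring TYPE('a)"
    and torsion_b: "two_torsion_free TYPE('b)" and semiprime_b: "semiprime_ring TYPE('b)"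
    and lact_nondegenerate: "(\<And>a. lact a m = 0) \<Longrightarrow> m = 0"
    and ract_nondegenerate: "(\<And>b. ract m b = 0) \<Longrightarrow> m = 0"
begin

lemmas anticommuting_a = semiprime_anticommuting_eq_0[OF torsion_a semiprime_a]
  and anticommuting_b = semiprime_anticommuting_eq_0[OF torsion_b semiprime_b]

lemma lact_faithful_eq:
  assumes "\<And>m. lact a m = lact a' m"
  shows "a = a'"
  using left_faithful[of "a - a'"] assms by (simp add: lact_left.diff)

lemma ract_faithful_eq:
  assumes "\<And>m. ract m b = ract m b'"
  shows "b = b'"
  using right_faithful[of "b - b'"] assms by (simp add: ract_right.diff)

lemma lact_nondegenerate_eq:
  assumes "\<And>a. lact a m = lact a m'"
  shows "m = m'"
  using lact_nondegenerate[of "m - m'"] assms by (simp add: lact_right.diff)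

lemma ract_nondegenerate_eq:
  assumes "\<And>b. ract m b = ract m' b"
  shows "m = m'"
  using ract_nondegenerate[of "m - m'"] assms by (simp add: ract_left.diff)

section \<open>Jordan derivations\<close>

text \<open>
  The maps \<open>\<mu>\<close> and \<open>\<nu>\<close> generalise the inner derivation by an off-diagonal matrix \<open>m\<^sub>0\<close>, for which
  \<open>\<mu> a\<close> and \<open>\<nu> b\<close> are, up to sign, \<open>a m\<^sub>0\<close> and \<open>m\<^sub>0 b\<close>.  They satisfy one-sided module
  identities because \<open>\<mu> a b = - a \<nu> b\<close>, so that a left factor of \<open>a\<close> can be moved out of \<open>\<mu>\<close>
  after multiplying by an arbitrary \<open>b\<close>, and that \<open>b\<close> can be cancelled.
\<close>

lemma jordan_derivation_tri_form:
  assumes "jordan_derivation tmul D"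
  obtains \<alpha> \<mu> g \<nu> \<beta>
  where "\<And>a m b. D (a, m, b) = (\<alpha> a, \<mu> a + g m + \<nu> b, \<beta> b)"
    and "\<And>m m'. g (m + m') = g m + g m'"
    and "\<And>a a'. \<alpha> (a * a') = \<alpha> a * a' + a * \<alpha> a'"
    and "\<And>b b'. \<beta> (b * b') = \<beta> b * b' + b * \<beta> b'"
    and "\<And>a m. g (lact a m) = lact (\<alpha> a) m + lact a (g m)"
    and "\<And>m b. g (ract m b) = ract m (\<beta> b) + ract (g m) b"
    and "\<And>a a'. \<mu> (a * a') = lact a (\<mu> a')"
    and "\<And>b b'. \<nu> (b * b') = ract (\<nu> b) b'"
    and "\<And>a b. ract (\<mu> a) b + lact a (\<nu> b) = 0"
proof -
  have addD: "additive D" using assms by (simp add: jordan_derivation_def)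
  have D0: "D (0, 0, 0) = 0"
    using additive.zero[OF addD] by (simp add: zero_prod_def)
  have jordan: "D (jordan_product tmul x y) = jordan_product tmul (D x) y + jordan_product tmul x (D y)"
    for x y using assms unfolding jordan_derivation_def by blast

  (* Names for the nine entries; the primed ones and f, h turn out to vanish. *)
  obtain \<alpha> \<mu> \<beta>' where DA: "\<And>a. D (a, 0, 0) = (\<alpha> a, \<mu> a, \<beta>' a)"
    using triple_valued_components[of "\<lambda>a. D (a, 0, 0)"] by blast
  obtain f g h where DM: "\<And>m. D (0, m, 0) = (f m, g m, h m)"
    using triple_valued_components[of "\<lambda>m. D (0, m, 0)"] by blast
  obtain \<alpha>' \<nu> \<beta> where DB: "\<And>b. D (0, 0, b) = (\<alpha>' b, \<nu> b, \<beta> b)"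
    using triple_valued_components[of "\<lambda>b. D (0, 0, b)"] by blast
  note entries = DA DM DB act_simps zero_prod_def

  have am: "f (lact a m) = a * f m + f m * a" "h (lact a m) = 0"
    "g (lact a m) = lact (\<alpha> a) m + ract m (\<beta>' a) + lact a (g m)" for a m
    using jordan[of "(a, 0, 0)" "(0, m, 0)"] by (simp_all add: entries)
  have mb: "f (ract m b) = 0" "h (ract m b) = b * h m + h m * b"
    "g (ract m b) = lact (\<alpha>' b) m + ract m (\<beta> b) + ract (g m) b" for m b
    using jordan[of "(0, m, 0)" "(0, 0, b)"] by (simp_all add: entries add_ac)
  have mm: "lact (f m) m' + ract m' (h m) + (ract m (h m') + lact (f m') m) = 0" for m m'
    using jordan[of "(0, m, 0)" "(0, m', 0)"] D0 by (simp add: entries)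
  have ab: "\<alpha>' b * a + a * \<alpha>' b = 0" "\<beta>' a * b + b * \<beta>' a = 0"
    "ract (\<mu> a) b + lact a (\<nu> b) = 0" for a b
    using jordan[of "(a, 0, 0)" "(0, 0, b)"] D0 by (simp_all add: entries add_ac)

  have \<alpha>'0: "\<alpha>' b = 0" for b using ab(1) by (rule anticommuting_a)
  have \<beta>'0: "\<beta>' a = 0" for a using ab(2) by (rule anticommuting_b)

  (* The entries f (m c) and h (a m) vanish, so only one term of mm survives for the
     arguments a (m c) and n b. *)
  have "h n = 0" for n
  proof (rule anticommuting_b)
    fix b
    have "lact a (ract m (c * (b * h n + h n * b))) = 0" for a m c
      using mm[of "lact a (ract m c)" "ract n b"]
      by (simp add: am mb act_simps ract_mult lact_ract)
    then have "ract m (c * (b * h n + h n * b)) = 0" for m c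
      by (rule lact_nondegenerate)
    then have "c * (b * h n + h n * b) = 0" for c
      by (rule right_faithful[OF allI])
    then show "h n * b + b * h n = 0"
      by (subst add.commute) (rule semiprime_left_cancel[OF semiprime_b])
  qed
  moreover have "f n = 0" for n
  proof (rule anticommuting_a)
    fix a
    have "ract (lact ((a * f n + f n * a) * c) m) b = 0" for b m c
      using mm[of "ract (lact c m) b" "lact a n"]
      by (simp add: am mb act_simps lact_mult flip: lact_ract)
    then have "lact ((a * f n + f n * a) * c) m = 0" for m c
      by (rule ract_nondegenerate)
    then have "(a * f n + f n * a) * c = 0" for c
      by (rule left_faithful[OF allI])
    then show "f n * a + a * f n = 0"
      by (subst add.commute) (rule semiprime_right_cancel[OF semiprime_a])
  qed
  ultimately have DM': "D (0, m, 0) = (0, g m, 0)" for m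
    by (simp add: DM)

  have g_lact: "g (lact a m) = lact (\<alpha> a) m + lact a (g m)" for a m
    by (simp add: am \<beta>'0 act_simps)
  have g_ract: "g (ract m b) = ract m (\<beta> b) + ract (g m) b" for m b
    by (simp add: mb \<alpha>'0 act_simps)

  show thesis
  proof (rule that)
    show "D (a, m, b) = (\<alpha> a, \<mu> a + g m + \<nu> b, \<beta> b)" for a m b
      by (subst additive_tri_split[OF addD]) (simp add: DA DM' DB \<alpha>'0 \<beta>'0)
    show "g (m + m') = g m + g m'" for m m'
      using additive.add[OF addD, of "(0, m, 0)" "(0, m', 0)"] by (simp add: DM')
    show "\<alpha> (a * a') = \<alpha> a * a' + a * \<alpha> a'" for a a'
    proof (rule lact_faithful_eq)
      fix m
      show "lact (\<alpha> (a * a')) m = lact (\<alpha> a * a' + a * \<alpha> a') m"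
        using g_lact[of "a * a'" m] g_lact[of a "lact a' m"]
        by (simp add: g_lact[of a' m] lact_mult act_simps add_ac)
    qed
    show "\<beta> (b * b') = \<beta> b * b' + b * \<beta> b'" for b b'
    proof (rule ract_faithful_eq)
      fix m
      show "ract m (\<beta> (b * b')) = ract m (\<beta> b * b' + b * \<beta> b')"
        using g_ract[of m "b * b'"] g_ract[of "ract m b" b']
        by (simp add: g_ract[of m b] ract_mult act_simps add_ac)
    qed
    have \<mu>_ract: "ract (\<mu> a) b = - lact a (\<nu> b)" for a b
      using ab(3) by (simp add: eq_neg_iff_add_eq_0)
    have lact_\<nu>: "lact a (\<nu> b) = - ract (\<mu> a) b" for a b
      by (simp add: \<mu>_ract)
    show "\<mu> (a * a') = lact a (\<mu> a')" for a a'
      by (rule ract_nondegenerate_eq)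
        (simp add: lact_ract \<mu>_ract lact_mult lact_right.minus)
    show "\<nu> (b * b') = ract (\<nu> b) b'" for b b'
      by (rule lact_nondegenerate_eq)
        (simp add: lact_\<nu> ract_mult ract_left.minus flip: lact_ract)
  qed (fact g_lact g_ract ab(3))+
qed

theorem jordan_derivation_tri_imp_derivation:
  assumes "jordan_derivation tmul D"
  shows "derivation tmul D"
proof -
  from assms obtain \<alpha> \<mu> g \<nu> \<beta>
    where D: "\<And>a m b. D (a, m, b) = (\<alpha> a, \<mu> a + g m + \<nu> b, \<beta> b)"
      and rules: "\<And>m m'. g (m + m') = g m + g m'"
        "\<And>a a'. \<alpha> (a * a') = \<alpha> a * a' + a * \<alpha> a'"
        "\<And>b b'. \<beta> (b * b') = \<beta> b * b' + b * \<beta> b'"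
        "\<And>a m. g (lact a m) = lact (\<alpha> a) m + lact a (g m)"
        "\<And>m b. g (ract m b) = ract m (\<beta> b) + ract (g m) b"
        "\<And>a a'. \<mu> (a * a') = lact a (\<mu> a')"
        "\<And>b b'. \<nu> (b * b') = ract (\<nu> b) b'"
      and mixed: "\<And>a b. ract (\<mu> a) b + lact a (\<nu> b) = 0"
    by (rule jordan_derivation_tri_form) (rule that)
  have "D (x \<star> y) = D x \<star> y + x \<star> D y" for x y
  proof (cases x rule: prod_cases3, cases y rule: prod_cases3)
    fix a m b a' m' b' assume "x = (a, m, b)" "y = (a', m', b')"
    moreover have "ract (\<mu> a) b' = - lact a (\<nu> b')"
      using mixed by (simp add: eq_neg_iff_add_eq_0)
    ultimately show ?thesis
      by (simp add: D rules act_simps algebra_simps)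
  qed
  with assms show ?thesis
    unfolding derivation_def jordan_derivation_def by blast
qed

section \<open>Jordan centralizers and generalized derivations\<close>

text \<open>
  The vanishing product \<open>a \<circ> b\<close> kills the off-diagonal entries of \<open>C a\<close> and \<open>C b\<close> outright:
  no derivation term is left to compensate for \<open>\<mu> a b\<close>.
\<close>

lemma jordan_centralizer_tri_form:
  assumes addC: "additive C"
    and left: "\<And>x y. C (jordan_product tmul x y) = jordan_product tmul (C x) y"
  obtains \<alpha> g \<beta>
  where "\<And>a m b. C (a, m, b) = (\<alpha> a, g m, \<beta> b)"
    and "\<And>m m'. g (m + m') = g m + g m'"
    and "\<And>a a'. \<alpha> (a * a') = \<alpha> a * a'" and "\<And>a a'. \<alpha> a * a' = a * \<alpha> a'"
    and "\<And>b b'. \<beta> (b * b') = \<beta> b * b'" and "\<And>b b'. \<beta> b * b' = b * \<beta> b'"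
    and "\<And>a m. g (lact a m) = lact (\<alpha> a) m" and "\<And>a m. lact (\<alpha> a) m = lact a (g m)"
    and "\<And>m b. g (ract m b) = ract m (\<beta> b)" and "\<And>m b. ract m (\<beta> b) = ract (g m) b"
proof -
  have C0: "C (0, 0, 0) = 0"
    using additive.zero[OF addC] by (simp add: zero_prod_def)
  have right: "C (jordan_product tmul x y) = jordan_product tmul x (C y)" for x y
    using left[of y x] by (simp add: jordan_product_commute)

  obtain \<alpha> \<mu> \<beta>' where CA: "\<And>a. C (a, 0, 0) = (\<alpha> a, \<mu> a, \<beta>' a)"
    using triple_valued_components[of "\<lambda>a. C (a, 0, 0)"] by blast
  obtain f g h where CM: "\<And>m. C (0, m, 0) = (f m, g m, h m)"
    using triple_valued_components[of "\<lambda>m. C (0, m, 0)"] by blast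
  obtain \<alpha>' \<nu> \<beta> where CB: "\<And>b. C (0, 0, b) = (\<alpha>' b, \<nu> b, \<beta> b)"
    using triple_valued_components[of "\<lambda>b. C (0, 0, b)"] by blast
  note entries = CA CM CB act_simps zero_prod_def

  have corners: "\<beta>' a * b + b * \<beta>' a = 0" "\<alpha>' b * a + a * \<alpha>' b = 0"
    and edges: "ract (\<mu> a) b = 0" "lact a (\<nu> b) = 0" for a b
    using left[of "(a, 0, 0)" "(0, 0, b)"] right[of "(a, 0, 0)" "(0, 0, b)"] C0
    by (simp_all add: entries add_ac)
  have CA': "C (a, 0, 0) = (\<alpha> a, 0, 0)" for a
    by (simp add: CA anticommuting_b[OF corners(1)] ract_nondegenerate[OF edges(1)])
  have CB': "C (0, 0, b) = (0, 0, \<beta> b)" for b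
    by (simp add: CB anticommuting_a[OF corners(2)] lact_nondegenerate[OF edges(2)])
  have "f m * a + a * f m = 0" for a m
    using left[of "(a, 0, 0)" "(0, m, 0)"] right[of "(a, 0, 0)" "(0, m, 0)"]
    by (simp add: CA' CM act_simps add.commute)
  then have "f m = 0" for m
    by (rule anticommuting_a)
  moreover have "h m * b + b * h m = 0" for m b
    using left[of "(0, m, 0)" "(0, 0, b)"] right[of "(0, m, 0)" "(0, 0, b)"]
    by (simp add: CB' CM act_simps)
  then have "h m = 0" for m
    by (rule anticommuting_b)
  ultimately have CM': "C (0, m, 0) = (0, g m, 0)" for m
    by (simp add: CM)

  have g_lact: "g (lact a m) = lact (\<alpha> a) m" and g_lact': "g (lact a m) = lact a (g m)" for a m
    using left[of "(a, 0, 0)" "(0, m, 0)"] right[of "(a, 0, 0)" "(0, m, 0)"]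
    by (simp_all add: CA' CM' act_simps)
  have g_ract: "g (ract m b) = ract m (\<beta> b)" and g_ract': "g (ract m b) = ract (g m) b" for m b
    using right[of "(0, m, 0)" "(0, 0, b)"] left[of "(0, m, 0)" "(0, 0, b)"]
    by (simp_all add: CB' CM' act_simps)

  show thesis
  proof (rule that)
    show "C (a, m, b) = (\<alpha> a, g m, \<beta> b)" for a m b
      by (subst additive_tri_split[OF addC]) (simp add: CA' CM' CB')
    show "g (m + m') = g m + g m'" for m m'
      using additive.add[OF addC, of "(0, m, 0)" "(0, m', 0)"] by (simp add: CM')
    show "\<alpha> (a * a') = \<alpha> a * a'" for a a'
      by (rule lact_faithful_eq) (simp add: lact_mult flip: g_lact)
    show "\<alpha> a * a' = a * \<alpha> a'" for a a'
      by (rule lact_faithful_eq) (metis lact_mult g_lact g_lact')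
    show "\<beta> (b * b') = \<beta> b * b'" for b b'
      by (rule ract_faithful_eq) (metis ract_mult g_ract g_ract')
    show "\<beta> b * b' = b * \<beta> b'" for b b'
      by (rule ract_faithful_eq) (metis ract_mult g_ract g_ract')
    show "lact (\<alpha> a) m = lact a (g m)" for a m
      using g_lact g_lact' by simp
    show "ract m (\<beta> b) = ract (g m) b" for m b
      using g_ract g_ract' by simp
  qed (fact g_lact g_ract)+
qed

lemma jordan_centralizer_tri_imp_centralizer:
  assumes "additive C"
    and "\<And>x y. C (jordan_product tmul x y) = jordan_product tmul (C x) y"
  shows "C (x \<star> y) = C x \<star> y" and "C (x \<star> y) = x \<star> C y"
proof -
  from assms obtain \<alpha> g \<beta>
    where C: "\<And>a m b. C (a, m, b) = (\<alpha> a, g m, \<beta> b)"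
      and add: "\<And>m m'. g (m + m') = g m + g m'"
      and \<alpha>: "\<And>a a'. \<alpha> (a * a') = \<alpha> a * a'" "\<And>a a'. \<alpha> a * a' = a * \<alpha> a'"
      and \<beta>: "\<And>b b'. \<beta> (b * b') = \<beta> b * b'" "\<And>b b'. \<beta> b * b' = b * \<beta> b'"
      and g: "\<And>a m. g (lact a m) = lact (\<alpha> a) m" "\<And>a m. lact (\<alpha> a) m = lact a (g m)"
        "\<And>m b. g (ract m b) = ract m (\<beta> b)" "\<And>m b. ract m (\<beta> b) = ract (g m) b"
    by (rule jordan_centralizer_tri_form) (rule that)
  obtain a m b a' m' b' where xy: "x = (a, m, b)" "y = (a', m', b')"
    by (metis prod_cases3)
  show "C (x \<star> y) = C x \<star> y"
    by (simp add: xy C add \<alpha>(1) \<beta>(1) g(1,3) flip: g(4))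
  show "C (x \<star> y) = x \<star> C y"
    by (simp add: xy C add \<alpha> \<beta> g(1-3))
qed

theorem jordan_generalized_derivation_tri_imp_two_sided:
  assumes "jordan_generalized_derivation tmul \<Phi> \<Delta>"
  shows "two_sided_generalized_derivation tmul \<Phi> \<Delta>"
proof -
  define \<Psi> where "\<Psi> x = \<Phi> x - \<Delta> x" for x
  have jd: "jordan_derivation tmul \<Delta>" and add\<Phi>: "additive \<Phi>"
    and jordan: "\<And>x y. \<Phi> (jordan_product tmul x y) =
      jordan_product tmul (\<Phi> x) y + jordan_product tmul x (\<Delta> y)"
    using assms unfolding jordan_generalized_derivation_def by blast+
  have der: "derivation tmul \<Delta>"
    using jd by (rule jordan_derivation_tri_imp_derivation)
  then have add\<Delta>: "additive \<Delta>" and leibniz: "\<And>x y. \<Delta> (x \<star> y) = \<Delta> x \<star> y + x \<star> \<Delta> y"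
    unfolding derivation_def by blast+
  have add\<Psi>: "additive \<Psi>"
    by (simp add: additive_def \<Psi>_def additive.add[OF add\<Phi>] additive.add[OF add\<Delta>])
  have central: "\<Psi> (jordan_product tmul x y) = jordan_product tmul (\<Psi> x) y" for x y
  proof -
    have "\<Delta> (jordan_product tmul x y) = jordan_product tmul (\<Delta> x) y + jordan_product tmul x (\<Delta> y)"
      using jd unfolding jordan_derivation_def by blast
    then show ?thesis
      by (simp add: \<Psi>_def jordan jordan_product_tri_diff_left)
  qed
  have \<Phi>: "\<Phi> x = \<Psi> x + \<Delta> x" for x by (simp add: \<Psi>_def)
  note centralizer = jordan_centralizer_tri_imp_centralizer[OF add\<Psi> central]
  have "\<Phi> (x \<star> y) = \<Phi> x \<star> y + x \<star> \<Delta> y" for x y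
    by (simp add: \<Phi> centralizer(1) leibniz tri_mult_add_left add_ac)
  moreover have "\<Phi> (x \<star> y) = x \<star> \<Phi> y + \<Delta> x \<star> y" for x y
    by (simp add: \<Phi> centralizer(2) leibniz tri_mult_add_right add_ac)
  ultimately show ?thesis
    unfolding two_sided_generalized_derivation_def using der add\<Phi> by blast
qed

end

theorem corollary2p11:
  fixes lact :: "'a::ring \<Rightarrow> 'm::ab_group_add \<Rightarrow> 'm"
    and ract :: "'m \<Rightarrow> 'b::ring \<Rightarrow> 'm"
    and \<Phi> \<Delta> :: "('a, 'm, 'b) tri \<Rightarrow> ('a, 'm, 'b) tri"
  assumes "two_torsion_free TYPE('a)" and "semiprime_ring TYPE('a)"
    and "two_torsion_free TYPE('b)" and "semiprime_ring TYPE('b)"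
    and "two_torsion_free TYPE('m)" and "faithful_bimodule lact ract"
    and "{m. \<forall>a. lact a m = 0} = {0}"
    and "{m. \<forall>b. ract m b = 0} = {0}"
    and "jordan_derivation (tri_mult lact ract) \<Delta>"
    and "jordan_generalized_derivation (tri_mult lact ract) \<Phi> \<Delta>"
  shows "derivation (tri_mult lact ract) \<Delta> \<and>
    two_sided_generalized_derivation (tri_mult lact ract) \<Phi> \<Delta>"
proof -
  interpret faithful_bimodule lact ract by (rule assms(6))
  interpret semiprime_bimodule lact ract
  proof
    show "m = 0" if "\<And>a. lact a m = 0" for m
    proof -
      from that have "m \<in> {m. \<forall>a. lact a m = 0}" by (intro CollectI allI)
      then show ?thesis unfolding assms(7) by (rule singletonD)
    qed
    show "m = 0" if "\<And>b. ract m b = 0" for m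
    proof -
      from that have "m \<in> {m. \<forall>b. ract m b = 0}" by (intro CollectI allI)
      then show ?thesis unfolding assms(8) by (rule singletonD)
    qed
  qed (rule assms(1-4))+
  show ?thesis
    using jordan_derivation_tri_imp_derivation[OF assms(9)]
      jordan_generalized_derivation_tri_imp_two_sided[OF assms(10)] by blast
qed

end
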